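(* Let $r\ge 2$ be an integer and let $T$ be a tight $r$-tree with $t\le 4$ edges. If $G$ is an $r$-graph that does not contain $T$, then $$e(G)\le\frac{t-1}{r}|\partial(G)|.$$
   Context: An $r$-graph is a (finite) $r$-uniform hypergraph; $e(G)$ is the number of edges of $G$. The shadow of an $r$-graph $G$ is $\partial(G)=\{S: |S|=r-1,\ S\subseteq e\text{ for some }e\in E(G)\}$. An $r$-graph $T$ is a tight $r$-tree if its edges can be ordered as $e_1,\dots,e_t$ ($t\ge 1$) so that for each $i\ge 2$ there are a vertex $v\in e_i$ and an index $1\le s\le i-1$ such that $v\notin\bigcup_{j=1}^{i-1}e_j$ and $e_i\setminus\{v\}\subset e_s$. The vertex set of a tight tree is the union of its edges. An $r$-graph $G$ contains $T$ if there is an injection $V(T)\to V(G)$ mapping every edge of $T$ to an edge of $G$. *)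

theory Defs
  imports Complex_Main
begin

definition r_graph :: "nat \<Rightarrow> 'a set \<Rightarrow> 'a set set \<Rightarrow> bool" where
  "r_graph r V E \<longleftrightarrow> finite V \<and> (\<forall>e\<in>E. e \<subseteq> V \<and> card e = r)"

definition shadow :: "nat \<Rightarrow> 'a set set \<Rightarrow> 'a set set" where
  "shadow r E = {S. card S = r - 1 \<and> (\<exists>e\<in>E. S \<subseteq> e)}"

text \<open>
  A tight tree is given by its edge set \<open>T\<close>; its vertex set is \<open>\<Union>T\<close>. The list \<open>es\<close> is the
  ordering of the edges, indexed from 0.
\<close>

definition tight_tree :: "nat \<Rightarrow> 'a set set \<Rightarrow> bool" where
  "tight_tree r T \<longleftrightarrow> r_graph r (\<Union>T) T \<and>
     (\<exists>es. distinct es \<and> set es = T \<and> es \<noteq> [] \<and>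
       (\<forall>i. 1 \<le> i \<and> i < length es \<longrightarrow>
         (\<exists>v\<in>es ! i. \<exists>s<i. v \<notin> (\<Union>j<i. es ! j) \<and> es ! i - {v} \<subseteq> es ! s)))"

text \<open>The \<open>r\<close>-graph with vertex set \<open>V\<close> and edge set \<open>E\<close> contains the one with edge set \<open>T\<close>.\<close>

definition contains_copy :: "'a set \<Rightarrow> 'a set set \<Rightarrow> 'b set set \<Rightarrow> bool" where
  "contains_copy V E T \<longleftrightarrow>
     (\<exists>f. inj_on f (\<Union>T) \<and> f ` \<Union>T \<subseteq> V \<and> (\<forall>e\<in>T. f ` e \<in> E))"

end

theory Submission
  imports Defs
begin

text \<open>
  A tight tree with at most four edges is a suspension: all its edges contain a common set \<open>R\<close>,
  and removing \<open>R\<close> leaves one of a few \<open>k\<close>-uniform patterns with \<open>k \<le> 3\<close> (a star of singletons,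
  two graph paths and a broom, a triple with a further triple on each of its pairs, the tight path
  on six vertices). Every link of an \<open>(r - k)\<close>-set in \<open>G\<close> avoids the pattern, and summing
  \<open>k e(L) \<le> (t - 1) |\<partial>L|\<close> over all links \<open>L\<close> gives \<open>r e(G) \<le> (t - 1) |\<partial>G|\<close>.

  For the patterns, the weights \<open>w(e) = \<Sum>v\<in>e. 1 / d(e - v)\<close> sum to \<open>|\<partial>L|\<close>, so a counterexample has
  an edge with \<open>w(e) < k / (t - 1)\<close>, whose codegrees are large enough to embed the pattern greedily.
  For the two paths with four edges one takes in addition a minimal counterexample: greedy
  embedding can only fail around a small configuration that is deletable, i.e. its removal
  destroys enough shadow.
\<close>

section \<open>Links and suspensions\<close>

text \<open>The condition \<open>v \<notin> S\<close> matters: without it, an edge \<open>S\<close>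
  of \<open>L\<close> would count its own vertices as neighbours.\<close>

definition nbr :: "'a set set \<Rightarrow> 'a set \<Rightarrow> 'a set" where
  "nbr L S = {v. v \<notin> S \<and> insert v S \<in> L}"

definition link :: "'a set set \<Rightarrow> 'a set \<Rightarrow> 'a set set" where
  "link E R = {I. I \<inter> R = {} \<and> R \<union> I \<in> E}"

text \<open>The condition on \<open>\<Union>P\<close> forces \<open>vs\<close> to have one entry for each vertex of the pattern.\<close>

definition realises :: "nat set set \<Rightarrow> 'a list \<Rightarrow> 'a set set \<Rightarrow> bool" where
  "realises P vs L \<longleftrightarrow> distinct vs \<and> \<Union>P = {..<length vs} \<and> (\<forall>I\<in>P. (!) vs ` I \<in> L)"

text \<open>Pattern vertices are indices into \<open>vs\<close>, so one pattern serves trees over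
  every vertex type. The equation \<open>card R + k = r\<close>, free of subtraction, also yields
  \<open>k \<le> r\<close>.\<close>

definition suspension :: "nat \<Rightarrow> nat \<Rightarrow> nat set set \<Rightarrow> 'a set set \<Rightarrow> bool" where
  "suspension r k P T \<longleftrightarrow> (\<exists>R vs. finite R \<and> card R + k = r \<and> distinct vs \<and> set vs \<inter> R = {} \<and>
     \<Union>P = {..<length vs} \<and> T = (\<lambda>I. R \<union> (!) vs ` I) ` P)"

lemma r_graphD:
  assumes "r_graph r V E"
  shows "finite V" "finite E" "\<And>e. e \<in> E \<Longrightarrow> e \<subseteq> V" "\<And>e. e \<in> E \<Longrightarrow> card e = r"
    "\<And>e. e \<in> E \<Longrightarrow> finite e"
proof -
  show "finite V" "\<And>e. e \<in> E \<Longrightarrow> e \<subseteq> V" "\<And>e. e \<in> E \<Longrightarrow> card e = r"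
    using assms by (auto simp: r_graph_def)
  then show "\<And>e. e \<in> E \<Longrightarrow> finite e"
    by (meson finite_subset)
  show "finite E"
    using assms by (auto simp: r_graph_def intro: finite_subset[of E "Pow V"])
qed

lemma r_graph_subset: "r_graph r V E \<Longrightarrow> A \<subseteq> E \<Longrightarrow> r_graph r V A"
  by (auto simp: r_graph_def)

lemma shadow_subset_Pow: "r_graph r V E \<Longrightarrow> shadow r E \<subseteq> Pow V"
  by (auto simp: shadow_def r_graph_def)

lemma finite_shadow: "r_graph r V E \<Longrightarrow> finite (shadow r E)"
  by (meson shadow_subset_Pow r_graphD(1) finite_Pow_iff finite_subset)

lemma finite_nbr:
  assumes "r_graph r V E"
  shows "finite (nbr E S)"
  using assms by (auto simp: nbr_def r_graph_def intro!: finite_subset[of _ V])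

text \<open>An edge above a set of size \<open>r - 1\<close> has exactly one further vertex. For
  \<open>r = 0\<close> truncated subtraction would put the empty edge into its own shadow.\<close>

lemma shadow_eq_nbr:
  assumes "r_graph r V E" "r \<ge> 1"
  shows "S \<in> shadow r E \<longleftrightarrow> finite S \<and> nbr E S \<noteq> {}"
proof
  assume "S \<in> shadow r E"
  then obtain e where e: "card S = r - 1" "e \<in> E" "S \<subseteq> e"
    by (auto simp: shadow_def)
  have "finite e" "card e = r"
    using r_graphD[OF assms(1)] e by auto
  then have fS: "finite S"
    using e finite_subset by auto
  have "card (e - S) = 1"
    using e fS \<open>card e = r\<close> assms(2) by (simp add: card_Diff_subset)
  then obtain v where "e - S = {v}"
    by (auto simp: card_1_singleton_iff)
  then have "v \<notin> S" "insert v S = e"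
    using e by auto
  then show "finite S \<and> nbr E S \<noteq> {}"
    using e fS by (auto simp: nbr_def)
next
  assume "finite S \<and> nbr E S \<noteq> {}"
  then obtain v where v: "finite S" "v \<notin> S" "insert v S \<in> E"
    by (auto simp: nbr_def)
  then have "card (insert v S) = r"
    using r_graphD[OF assms(1)] by auto
  then show "S \<in> shadow r E"
    using v by (auto simp: shadow_def intro!: bexI[of _ "insert v S"])
qed

text \<open>Send \<open>R\<close> to \<open>R'\<close> by any bijection and each
  \<open>vs ! i\<close> to \<open>ws ! i\<close>; the two parts stay disjoint, and edges of the tree
  become \<open>R'\<close> together with edges of its link.\<close>

lemma realises_copy:
  assumes E: "r_graph r V E"
    and T: "suspension r k P T"
    and R': "finite R'" "card R' + k = r"
    and ws: "realises P ws (link E R')"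
  shows "contains_copy V E T"
proof -
  obtain R vs where R: "finite R" "card R + k = r" "distinct vs" "set vs \<inter> R = {}"
     "\<Union>P = {..<length vs}" "T = (\<lambda>I. R \<union> (!) vs ` I) ` P"
    using T by (auto simp: suspension_def)
  have "{..<length vs} = {..<length ws}"
    using R(5) ws by (simp add: realises_def)
  then have len: "length vs = length ws"
    by simp
  have dw: "distinct ws"
    using ws by (simp add: realises_def)
  have P_lt: "i < length ws" if "I \<in> P" "i \<in> I" for I i
    using R(5) that len by auto
  \<comment> \<open>The members of \<open>P\<close> cover all indices, so each \<open>ws ! i\<close>
    lies in an edge of the link and hence outside \<open>R'\<close>.\<close>
  have disj: "set ws \<inter> R' = {}"
  proof -
    have "ws ! i \<notin> R'" if i: "i < length ws" for i
    proof -
      obtain I where I: "I \<in> P" "i \<in> I"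
        using R(5) i len by auto
      then have "(!) ws ` I \<inter> R' = {}"
        using ws by (auto simp: realises_def link_def)
      then show ?thesis
        using I by auto
    qed
    then show ?thesis
      by (auto simp: in_set_conv_nth)
  qed
  obtain h where h: "bij_betw h R R'"
    using R(1,2) R' finite_same_card_bij[of R R'] by auto
  define f where "f x = (if x \<in> R then h x else the (map_of (zip vs ws) x))" for x
  have fR: "f ` R = R'"
    using h by (auto simp: f_def bij_betw_def)
  have fv: "f (vs ! i) = ws ! i" if "i < length ws" for i
  proof -
    have "vs ! i \<in> set vs"
      using that len by simp
    then have "vs ! i \<notin> R"
      using R(4) by auto
    then show ?thesis
      using that len R(3) by (simp add: f_def map_of_zip_nth)
  qed
  have inj: "inj_on f (R \<union> set vs)"
  proof -
    have 1: "inj_on f R"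
      using h by (simp add: f_def bij_betw_def inj_on_def)
    have 2: "inj_on f (set vs)"
      using fv len dw by (auto simp: inj_on_def in_set_conv_nth nth_eq_iff_index_eq)
    have "f ` set vs \<subseteq> set ws"
    proof
      fix y assume "y \<in> f ` set vs"
      then obtain i where "i < length vs" "y = f (vs ! i)"
        by (metis imageE in_set_conv_nth)
      then show "y \<in> set ws"
        using fv len by simp
    qed
    then have "f ` (R - set vs) \<inter> f ` (set vs - R) = {}"
      using fR disj by blast
    then show ?thesis
      using 1 2 by (simp add: inj_on_Un)
  qed
  have sub: "\<Union>T \<subseteq> R \<union> set vs"
    using P_lt len by (auto simp: R(6))
  have edges: "f ` e \<in> E" if e: "e \<in> T" for e
  proof -
    obtain I where I: "I \<in> P" "e = R \<union> (!) vs ` I"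
      using e R(6) by auto
    have "f ` (!) vs ` I = (!) ws ` I"
      using P_lt[OF I(1)] fv by (auto simp: image_image)
    then have "f ` e = R' \<union> (!) ws ` I"
      using fR I by (simp add: image_Un)
    then show ?thesis
      using ws I by (auto simp: realises_def link_def)
  qed
  have "f ` \<Union>T \<subseteq> V"
    using edges r_graphD(3)[OF E] by blast
  then show ?thesis
    unfolding contains_copy_def using inj_on_subset[OF inj sub] edges by blast
qed

section \<open>Double counting over links\<close>

lemma r_graph_link:
  assumes "r_graph r V E" "finite R" "card R + k = r"
  shows "r_graph k V (link E R)"
  unfolding r_graph_def
proof (intro conjI ballI)
  show "finite V"
    using assms r_graphD by auto
  fix I assume "I \<in> link E R"
  then have I: "I \<inter> R = {}" "R \<union> I \<in> E"
    by (auto simp: link_def)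
  then show "I \<subseteq> V"
    using r_graphD[OF assms(1)] by auto
  have "finite (R \<union> I)" "card (R \<union> I) = r"
    using r_graphD[OF assms(1)] I by auto
  then show "card I = k"
    using I assms by (simp add: card_Un_disjoint Int_commute)
qed

text \<open>Both sides count pairs \<open>R \<subseteq> e\<close> with
  \<open>card R = r - k\<close>, once by \<open>R\<close> and once by \<open>e\<close>.\<close>

lemma sum_card_link:
  assumes E: "r_graph r V E" and k: "k \<le> r"
  shows "(\<Sum>R | R \<subseteq> V \<and> card R = r - k. card (link E R)) = (r choose k) * card E"
proof -
  let ?\<R> = "{R. R \<subseteq> V \<and> card R = r - k}"
  have finR: "finite ?\<R>"
    using r_graphD(1)[OF E] by auto
  have "card (link E R) = card {e \<in> E. R \<subseteq> e}" for R
  proof (rule bij_betw_same_card)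
    show "bij_betw (\<lambda>I. R \<union> I) (link E R) {e \<in> E. R \<subseteq> e}"
      by (rule bij_betw_byWitness[where f' = "\<lambda>e. e - R"]) (auto simp: link_def Un_absorb1)
  qed
  then have "(\<Sum>R\<in>?\<R>. card (link E R)) = (\<Sum>R\<in>?\<R>. card {e \<in> E. R \<subseteq> e})"
    by simp
  also have "\<dots> = (\<Sum>e\<in>E. card {R \<in> ?\<R>. R \<subseteq> e})"
    using sum.swap_restrict[OF finR r_graphD(2)[OF E], of "\<lambda>_ _. 1::nat" "\<lambda>R e. R \<subseteq> e"] by simp
  also have "\<dots> = (\<Sum>e\<in>E. (r choose k))"
  proof (rule sum.cong[OF refl])
    fix e assume e: "e \<in> E"
    then have "{R \<in> ?\<R>. R \<subseteq> e} = {R. R \<subseteq> e \<and> card R = r - k}"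
      using r_graphD(3)[OF E] by auto
    then show "card {R \<in> ?\<R>. R \<subseteq> e} = (r choose k)"
      using n_subsets[of e "r - k"] r_graphD(4,5)[OF E e] binomial_symmetric[OF k] by simp
  qed
  finally show ?thesis
    by simp
qed

text \<open>Membership of \<open>S\<close> on either side means that \<open>S\<close> avoids
  \<open>R\<close> and some vertex extends \<open>R \<union> S\<close> to an edge of
  \<open>E\<close>.\<close>

lemma shadow_link:
  assumes E: "r_graph r V E" and R: "finite R" "card R + k = r" and k: "k \<ge> 1"
  shows "shadow k (link E R) = link (shadow r E) R"
proof -
  have L: "r_graph k V (link E R)"
    using r_graph_link[OF E R] .
  have r: "r \<ge> 1"
    using R k by simp
  have "S \<in> shadow k (link E R) \<longleftrightarrow> S \<in> link (shadow r E) R" for S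
  proof
    assume "S \<in> shadow k (link E R)"
    then obtain v where v: "finite S" "v \<notin> S" "insert v S \<in> link E R"
      unfolding shadow_eq_nbr[OF L k] by (auto simp: nbr_def)
    then have "v \<in> nbr E (R \<union> S)" "S \<inter> R = {}"
      by (auto simp: nbr_def link_def)
    then show "S \<in> link (shadow r E) R"
      unfolding link_def using shadow_eq_nbr[OF E r] v R by auto
  next
    assume "S \<in> link (shadow r E) R"
    then obtain v where v: "finite S" "S \<inter> R = {}" "v \<in> nbr E (R \<union> S)"
      unfolding link_def using shadow_eq_nbr[OF E r] by auto
    then have "v \<in> nbr (link E R) S"
      by (auto simp: nbr_def link_def)
    then show "S \<in> shadow k (link E R)"
      using shadow_eq_nbr[OF L k] v by auto
  qed
  then show ?thesis
    by blast
qed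

text \<open>Summed over all \<open>R\<close>, an edge is counted \<open>r choose k\<close> times and
  a shadow set \<open>(r - 1) choose (k - 1)\<close> times. The absorption identity
  \<open>pascal\<close> turns the factor \<open>k\<close> of the links into
  \<open>r\<close>.\<close>

lemma shadow_bound_from_links:
  assumes E: "r_graph r V E" and k: "1 \<le> k" "k \<le> r"
    and bound: "\<And>R. finite R \<Longrightarrow> card R + k = r \<Longrightarrow>
      k * card (link E R) \<le> m * card (shadow k (link E R))"
  shows "r * card E \<le> m * card (shadow r E)"
proof -
  let ?\<R> = "{R. R \<subseteq> V \<and> card R = r - k}"
  have fin: "finite R \<and> card R + k = r" if "R \<in> ?\<R>" for R
    using that k r_graphD(1)[OF E] by (auto intro: finite_subset)
  \<comment> \<open>The shadow is an \<open>(r - 1)\<close>-graph, so its links of uniformity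
    \<open>k - 1\<close> can be counted by the same double count.\<close>
  have shadow_graph: "r_graph (r - 1) V (shadow r E)"
    using E by (auto simp: r_graph_def shadow_def)
  have pascal: "k * (r choose k) = r * ((r - 1) choose (k - 1))"
    using times_binomial_minus1_eq[of k r] k by simp
  have "((r - 1) choose (k - 1)) * (r * card E) = k * ((r choose k) * card E)"
    using pascal by (metis mult.assoc mult.commute)
  also have "\<dots> = (\<Sum>R\<in>?\<R>. k * card (link E R))"
    unfolding sum_distrib_left[symmetric] sum_card_link[OF E k(2)] ..
  also have "\<dots> \<le> (\<Sum>R\<in>?\<R>. m * card (link (shadow r E) R))"
  proof (rule sum_mono)
    fix R assume "R \<in> ?\<R>"
    then show "k * card (link E R) \<le> m * card (link (shadow r E) R)"
      using fin[of R] bound[of R] shadow_link[OF E, of R k] k by simp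
  qed
  also have "\<dots> = m * (((r - 1) choose (k - 1)) * card (shadow r E))"
    unfolding sum_distrib_left[symmetric] using sum_card_link[OF shadow_graph, of "k - 1"] k by simp
  finally have "((r - 1) choose (k - 1)) * (r * card E) \<le>
      ((r - 1) choose (k - 1)) * (m * card (shadow r E))"
    by (simp add: algebra_simps)
  moreover have "(r - 1) choose (k - 1) > 0"
    using k by (simp add: zero_less_binomial)
  ultimately show ?thesis
    by simp
qed

text \<open>Reduces the problem to \<open>k\<close>-graphs: a pattern found in the link of some
  \<open>R\<close> would extend by \<open>R\<close> to a copy of \<open>T\<close>.\<close>

lemma suspension_bound:
  fixes T :: "'b set set" and E :: "'a set set"
  assumes E: "r_graph r V E" and k: "1 \<le> k"
    and T: "suspension r k P T" and free: "\<not> contains_copy V E T"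
    and bound: "\<And>L :: 'a set set. r_graph k V L \<Longrightarrow> (\<And>ws. \<not> realises P ws L) \<Longrightarrow>
      k * card L \<le> m * card (shadow k L)"
  shows "r * card E \<le> m * card (shadow r E)"
proof -
  have "k \<le> r"
    using T by (auto simp: suspension_def)
  then show ?thesis
    using shadow_bound_from_links[OF E k _ bound] r_graph_link[OF E] realises_copy[OF E T] free
    by blast
qed

section \<open>Light edges and deletion\<close>

text \<open>Regroup the pairs \<open>(e, v)\<close> by \<open>S = e - {v}\<close>: each shadow set
  receives its codegree many terms, each the reciprocal of that codegree.\<close>

lemma weight_sum:
  assumes L: "r_graph k V L" and k: "k \<ge> 1"
  shows "(\<Sum>e\<in>L. \<Sum>v\<in>e. 1 / real (card (nbr L (e - {v})))) = real (card (shadow k L))"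
proof -
  let ?d = "\<lambda>S. real (card (nbr L S))"
  have "(\<Sum>e\<in>L. \<Sum>v\<in>e. 1 / ?d (e - {v})) = (\<Sum>(e, v)\<in>Sigma L (\<lambda>e. e). 1 / ?d (e - {v}))"
    using r_graphD[OF L] by (subst sum.Sigma) auto
  also have "\<dots> = (\<Sum>(S, v)\<in>Sigma (shadow k L) (nbr L). 1 / ?d S)"
  proof (rule sum.reindex_bij_witness[where i = "\<lambda>(S, v). (insert v S, v)"
        and j = "\<lambda>(e, v). (e - {v}, v)"])
    fix p assume "p \<in> Sigma L (\<lambda>e. e)"
    then obtain e v where p: "p = (e, v)" "e \<in> L" "v \<in> e"
      by auto
    then have "v \<in> nbr L (e - {v})" "finite (e - {v})"
      using r_graphD[OF L] by (auto simp: nbr_def insert_absorb)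
    then show "(case p of (e, v) \<Rightarrow> (e - {v}, v)) \<in> Sigma (shadow k L) (nbr L)"
      using shadow_eq_nbr[OF L k] p by auto
  qed (auto simp: nbr_def insert_absorb)
  also have "\<dots> = (\<Sum>S\<in>shadow k L. \<Sum>v\<in>nbr L S. 1 / ?d S)"
    using finite_shadow[OF L] finite_nbr[OF L] by (subst sum.Sigma) auto
  also have "\<dots> = (\<Sum>S\<in>shadow k L. 1)"
    using shadow_eq_nbr[OF L k] finite_nbr[OF L] by (intro sum.cong) auto
  finally show ?thesis
    by simp
qed

text \<open>Averaging: if every edge weighed at least \<open>k / m\<close>, the total weight, which
  is the size of the shadow, would be at least \<open>card L * k / m\<close>.\<close>

lemma light_edge:
  assumes L: "r_graph k V L" and k: "k \<ge> 1" and m: "m \<ge> 1"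
    and dense: "m * card (shadow k L) < k * card L"
  obtains e where "e \<in> L" "(\<Sum>v\<in>e. 1 / real (card (nbr L (e - {v})))) < real k / real m"
proof (rule ccontr)
  let ?w = "\<lambda>e. \<Sum>v\<in>e. 1 / real (card (nbr L (e - {v})))"
  assume "\<not> thesis"
  then have "real k / real m \<le> ?w e" if "e \<in> L" for e
    using that \<open>\<And>e. e \<in> L \<Longrightarrow> ?w e < real k / real m \<Longrightarrow> thesis\<close> by force
  then have "(\<Sum>e\<in>L. real k / real m) \<le> (\<Sum>e\<in>L. ?w e)"
    by (intro sum_mono)
  then have "real (card L) * (real k / real m) \<le> real (card (shadow k L))"
    using weight_sum[OF L k] by simp
  then have "real (k * card L) \<le> real (m * card (shadow k L))"
    using m by (simp add: field_simps)
  then show False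
    using dense by linarith
qed

text \<open>Every edge above a member of \<open>K\<close> lies in \<open>A\<close>, so deleting
  \<open>A\<close> removes all of \<open>K\<close> from the shadow; this loss pays for the deleted
  edges.\<close>

lemma shadow_bound_deletion:
  assumes L: "r_graph k V L" and A: "A \<subseteq> L" and K: "K \<subseteq> shadow k L"
    and killed: "\<And>S e. S \<in> K \<Longrightarrow> e \<in> L \<Longrightarrow> S \<subseteq> e \<Longrightarrow> e \<in> A"
    and few: "k * card A \<le> m * card K"
    and rest: "k * card (L - A) \<le> m * card (shadow k (L - A))"
  shows "k * card L \<le> m * card (shadow k L)"
proof -
  have fin: "finite (shadow k L)" "finite L"
    using finite_shadow[OF L] r_graphD[OF L] by auto
  have "shadow k (L - A) \<subseteq> shadow k L - K"
    using killed by (auto simp: shadow_def)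
  then have "card (shadow k (L - A)) \<le> card (shadow k L - K)"
    using fin by (intro card_mono) auto
  also have "\<dots> = card (shadow k L) - card K"
    using K fin by (meson card_Diff_subset finite_subset)
  finally have "card (shadow k (L - A)) + card K \<le> card (shadow k L)"
    using card_mono[OF fin(1) K] by linarith
  then have "m * card (shadow k (L - A)) + m * card K \<le> m * card (shadow k L)"
    by (metis add_mult_distrib2 mult_le_mono2)
  moreover have "card L = card A + card (L - A)"
    using A fin by (metis add.commute card_Diff_subset card_mono finite_subset le_add_diff_inverse2)
  then have "k * card L = k * card A + k * card (L - A)"
    by (simp add: add_mult_distrib2)
  ultimately show ?thesis
    using few rest by linarith
qed

section \<open>Shadow bounds for the patterns\<close>

text \<open>Edges through a common \<open>(r - 1)\<close>-set differ in one private vertex each,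
  which leaves singletons.\<close>

definition star :: "nat \<Rightarrow> nat set set" where
  "star t = (\<lambda>i. {i}) ` {..<t}"

definition path3 :: "nat set set" where
  "path3 = {{0, 1}, {1, 2}, {2, 3}}"

definition path4 :: "nat set set" where
  "path4 = {{0, 1}, {1, 2}, {2, 3}, {3, 4}}"

text \<open>The spider with centre \<open>2\<close> and legs of lengths 1, 1 and 2.\<close>

definition broom :: "nat set set" where
  "broom = {{0, 2}, {1, 2}, {2, 3}, {3, 4}}"

definition spokes :: "nat set set" where
  "spokes = {{0, 1, 2}, {1, 2, 3}, {0, 2, 4}, {0, 1, 5}}"

definition tight_path :: "nat set set" where
  "tight_path = {{0, 1, 2}, {1, 2, 3}, {2, 3, 4}, {3, 4, 5}}"

lemma Union_patterns:
  "\<Union>(star t) = {..<t}" "\<Union>path3 = {..<4}" "\<Union>path4 = {..<5}" "\<Union>broom = {..<5}"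
  "\<Union>spokes = {..<6}" "\<Union>tight_path = {..<6}"
proof -
  show "\<Union>(star t) = {..<t}"
    by (auto simp: star_def)
qed (simp_all add: path3_def path4_def broom_def spokes_def tight_path_def
    numeral_eq_Suc lessThan_Suc insert_commute)

lemma realises_patterns:
  "realises path3 [v0, v1, v2, v3] L \<longleftrightarrow>
     distinct [v0, v1, v2, v3] \<and> {{v0, v1}, {v1, v2}, {v2, v3}} \<subseteq> L"
  "realises path4 [v0, v1, v2, v3, v4] L \<longleftrightarrow>
     distinct [v0, v1, v2, v3, v4] \<and> {{v0, v1}, {v1, v2}, {v2, v3}, {v3, v4}} \<subseteq> L"
  "realises broom [v0, v1, v2, v3, v4] L \<longleftrightarrow>
     distinct [v0, v1, v2, v3, v4] \<and> {{v0, v2}, {v1, v2}, {v2, v3}, {v3, v4}} \<subseteq> L"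
  "realises spokes [v0, v1, v2, v3, v4, v5] L \<longleftrightarrow> distinct [v0, v1, v2, v3, v4, v5] \<and>
     {{v0, v1, v2}, {v1, v2, v3}, {v0, v2, v4}, {v0, v1, v5}} \<subseteq> L"
  "realises tight_path [v0, v1, v2, v3, v4, v5] L \<longleftrightarrow> distinct [v0, v1, v2, v3, v4, v5] \<and>
     {{v0, v1, v2}, {v1, v2, v3}, {v2, v3, v4}, {v3, v4, v5}} \<subseteq> L"
  unfolding realises_def Union_patterns
  by (simp_all add: path3_def path4_def broom_def spokes_def tight_path_def)

text \<open>The shadow of a nonempty 1-graph is \<open>{{}}\<close>, and any \<open>t\<close> of its
  edges realise the star. The factor 1 keeps the shape required by
  \<open>suspension_bound\<close>.\<close>

lemma star_bound:
  assumes L: "r_graph 1 V L" and free: "\<And>ws. \<not> realises (star t) ws L"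
  shows "1 * card L \<le> (t - 1) * card (shadow 1 L)"
proof (cases "L = {}")
  case False
  define X where "X = \<Union>L"
  have single: "\<exists>x. e = {x}" if "e \<in> L" for e
    using r_graphD(4)[OF L that] by (simp add: card_1_singleton_iff)
  then have LX: "L = (\<lambda>x. {x}) ` X"
    unfolding X_def by fastforce
  then have cX: "card L = card X"
    by (simp add: card_image)
  have "finite X"
    using r_graphD[OF L] by (auto simp: X_def)
  have "shadow 1 L = {{}}"
    using False L by (auto simp: shadow_eq_nbr nbr_def LX shadow_def dest: r_graphD(5)[OF L] finite_subset)
  moreover have "card X < t"
  proof (rule ccontr)
    assume "\<not> card X < t"
    then obtain Y where Y: "Y \<subseteq> X" "card Y = t"
      by (meson linorder_not_less obtain_subset_with_card_n)
    then obtain ws where ws: "set ws = Y" "distinct ws"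
      using finite_distinct_list[of Y] \<open>finite X\<close> finite_subset by auto
    then have "length ws = t"
      using Y distinct_card by fastforce
    then have "realises (star t) ws L"
      unfolding realises_def Union_patterns using ws Y by (auto simp: star_def LX image_iff dest: nth_mem)
    then show False
      using free by blast
  qed
  ultimately show ?thesis
    using cX by simp
qed auto

section \<open>Greedy embedding around a light edge\<close>

lemma obtain_new:
  assumes "length xs < card A"
  obtains x where "x \<in> A" "x \<notin> set xs"
proof -
  have "\<not> A \<subseteq> set xs"
  proof
    assume "A \<subseteq> set xs"
    then have "card A \<le> card (set xs)"
      by (intro card_mono) auto
    then show False
      using card_length[of xs] assms by linarith
  qed
  then show thesis
    using that by blast
qed

lemma nbr_pos:
  assumes L: "r_graph k V L" and e: "e \<in> L" "v \<in> e"
  shows "card (nbr L (e - {v})) \<ge> 1"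
proof -
  have "v \<in> nbr L (e - {v})"
    using e by (auto simp: nbr_def insert_absorb)
  then show ?thesis
    using finite_nbr[OF L] by (metis One_nat_def Suc_leI card_gt_0_iff empty_iff)
qed

lemma recip_le:
  assumes "p \<ge> 1" "p \<le> q"
  shows "1 / real q \<le> 1 / real p"
  using assms by (simp add: frac_le)

text \<open>The reciprocals of the two degrees sum to less than \<open>2 / m\<close>, which is at
  most 1. So neither degree is 1, and they are not both at most \<open>m\<close>.\<close>

lemma light_pair:
  assumes L: "r_graph 2 V L" and m: "m \<ge> 2" "m * card (shadow 2 L) < 2 * card L"
  obtains a b where "{a, b} \<in> L" "a \<noteq> b" "card (nbr L {a}) > m" "card (nbr L {b}) \<ge> 2"
proof -
  let ?d = "\<lambda>S. card (nbr L S)"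
  obtain e where e: "e \<in> L" "(\<Sum>v\<in>e. 1 / real (?d (e - {v}))) < real 2 / real m"
    using light_edge[OF L, of m] m by auto
  obtain a b where ab: "e = {a, b}" "a \<noteq> b"
    using r_graphD(4)[OF L e(1)] by (auto simp: card_2_iff)
  have diff: "e - {a} = {b}" "e - {b} = {a}"
    using ab by auto
  have w: "1 / real (?d {a}) + 1 / real (?d {b}) < 2 / real m"
    using e(2) ab diff by (simp add: add.commute)
  have pos: "?d {a} \<ge> 1" "?d {b} \<ge> 1"
    using nbr_pos[OF L e(1), of b] nbr_pos[OF L e(1), of a] unfolding diff by (auto simp: ab)
  have "2 / real m \<le> 1" "0 \<le> 1 / real (?d {a})" "0 \<le> 1 / real (?d {b})"
    using m by simp_all
  then have "1 / real (?d {a}) < 1" "1 / real (?d {b}) < 1"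
    using w by linarith+
  then have "?d {a} \<noteq> 1" "?d {b} \<noteq> 1"
    by auto
  then have two: "?d {a} \<ge> 2" "?d {b} \<ge> 2"
    using pos by linarith+
  have "?d {a} > m \<or> ?d {b} > m"
  proof (rule ccontr)
    assume "\<not> ?thesis"
    then have "1 / real m \<le> 1 / real (?d {a})" "1 / real m \<le> 1 / real (?d {b})"
      using recip_le pos by auto
    then show False
      using w by simp
  qed
  then show thesis
    using that[of a b] that[of b a] e(1) ab two by (metis insert_commute)
qed

text \<open>The light edge becomes the middle edge. Its end \<open>b\<close> of smaller guaranteed
  degree is served first; three neighbours of \<open>a\<close> then suffice to avoid
  \<open>b\<close> and \<open>x\<close>.\<close>

lemma path3_bound:
  assumes L: "r_graph 2 V L" and free: "\<And>ws. \<not> realises path3 ws L"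
  shows "2 * card L \<le> 2 * card (shadow 2 L)"
proof (rule ccontr)
  assume "\<not> ?thesis"
  then obtain a b where ab: "{a, b} \<in> L" "a \<noteq> b" "card (nbr L {a}) > 2" "card (nbr L {b}) \<ge> 2"
    using light_pair[OF L, of 2] by auto
  obtain x where x: "x \<in> nbr L {b}" "x \<notin> set [a]"
    using obtain_new[of "[a]" "nbr L {b}"] ab by auto
  obtain y where y: "y \<in> nbr L {a}" "y \<notin> set [b, x]"
    using obtain_new[of "[b, x]" "nbr L {a}"] ab by auto
  have "realises path3 [y, a, b, x] L"
    using ab x y by (auto simp: realises_patterns nbr_def insert_commute)
  then show False
    using free by blast
qed

text \<open>The vertex \<open>a\<close> of degree at least 4 becomes the centre, with room for two
  leaves besides \<open>b\<close> and the vertex \<open>x\<close> beyond it.\<close>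

lemma broom_bound:
  assumes L: "r_graph 2 V L" and free: "\<And>ws. \<not> realises broom ws L"
  shows "2 * card L \<le> 3 * card (shadow 2 L)"
proof (rule ccontr)
  assume "\<not> ?thesis"
  then obtain a b where ab: "{a, b} \<in> L" "a \<noteq> b" "card (nbr L {a}) > 3" "card (nbr L {b}) \<ge> 2"
    using light_pair[OF L, of 3] by auto
  obtain x where x: "x \<in> nbr L {b}" "x \<notin> set [a]"
    using obtain_new[of "[a]" "nbr L {b}"] ab by auto
  obtain y where y: "y \<in> nbr L {a}" "y \<notin> set [b, x]"
    using obtain_new[of "[b, x]" "nbr L {a}"] ab by auto
  obtain z where z: "z \<in> nbr L {a}" "z \<notin> set [b, x, y]"
    using obtain_new[of "[b, x, y]" "nbr L {a}"] ab by auto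
  have "realises broom [y, z, a, b, x] L"
    using ab x y z by (auto simp: realises_patterns nbr_def insert_commute)
  then show False
    using free by blast
qed

text \<open>The reciprocals of the three codegrees sum to less than 1. In increasing order, the
  first exceeds 1, the second exceeds 2 (else 1/2 + 1/2) and the third exceeds 3 (else three times
  1/3).\<close>

lemma light_triple:
  assumes L: "r_graph 3 V L" and m: "3 * card (shadow 3 L) < 3 * card L"
  obtains a b d where "{a, b, d} \<in> L" "distinct [a, b, d]"
    "card (nbr L {b, d}) \<ge> 2" "card (nbr L {a, b}) \<ge> 3" "card (nbr L {a, d}) \<ge> 4"
proof -
  let ?d = "\<lambda>x y. card (nbr L {x, y})"
  let ?i = "\<lambda>x y. 1 / real (?d x y)"
  obtain e where e: "e \<in> L" "(\<Sum>v\<in>e. 1 / real (card (nbr L (e - {v})))) < real 3 / real 3"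
    using light_edge[OF L, of 3] m by auto
  obtain x y z where xyz: "e = {x, y, z}" "distinct [x, y, z]"
    using r_graphD(4)[OF L e(1)] by (auto simp: card_3_iff)
  have diff: "e - {x} = {y, z}" "e - {y} = {x, z}" "e - {z} = {x, y}"
    using xyz by auto
  have w: "?i x y + ?i x z + ?i y z < 1"
    using e(2) xyz diff by (simp add: add_ac)
  have pos: "?d x y \<ge> 1" "?d x z \<ge> 1" "?d y z \<ge> 1"
    using nbr_pos[OF L e(1), of z] nbr_pos[OF L e(1), of y] nbr_pos[OF L e(1), of x]
    unfolding diff by (auto simp: xyz)
  \<comment> \<open>Rename the vertices so that the codegrees of \<open>{b, d}\<close>,
    \<open>{a, b}\<close>, \<open>{a, d}\<close> are increasing; the six cases are the possible
    orders.\<close>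
  obtain a b d where abd: "{a, b, d} \<in> L" "distinct [a, b, d]" "?i a b + ?i a d + ?i b d < 1"
      "?d b d \<ge> 1" "?d a b \<ge> ?d b d" "?d a d \<ge> ?d a b"
  proof -
    have e': "{x, y, z} \<in> L" "{x, z, y} \<in> L" "{y, x, z} \<in> L" "{y, z, x} \<in> L"
      "{z, x, y} \<in> L" "{z, y, x} \<in> L"
      using e(1) unfolding xyz(1) by (simp_all add: insert_commute)
    have c: "?d y x = ?d x y" "?d z x = ?d x z" "?d z y = ?d y z"
      by (simp_all add: insert_commute)
    consider "?d y z \<le> ?d x y" "?d x y \<le> ?d x z" | "?d y z \<le> ?d x z" "?d x z \<le> ?d x y"
      | "?d x z \<le> ?d x y" "?d x y \<le> ?d y z" | "?d x z \<le> ?d y z" "?d y z \<le> ?d x y"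
      | "?d x y \<le> ?d x z" "?d x z \<le> ?d y z" | "?d x y \<le> ?d y z" "?d y z \<le> ?d x z"
      by linarith
    then show thesis
    proof cases
      case 1
      show thesis
        by (rule that[of x y z]) (use 1 xyz(2) e' w pos c in auto)
    next
      case 2
      show thesis
        by (rule that[of x z y]) (use 2 xyz(2) e' w pos c in auto)
    next
      case 3
      show thesis
        by (rule that[of y x z]) (use 3 xyz(2) e' w pos c in auto)
    next
      case 4
      show thesis
        by (rule that[of y z x]) (use 4 xyz(2) e' w pos c in auto)
    next
      case 5
      show thesis
        by (rule that[of z x y]) (use 5 xyz(2) e' w pos c in auto)
    next
      case 6
      show thesis
        by (rule that[of z y x]) (use 6 xyz(2) e' w pos c in auto)
    qed
  qed
  have i0: "?i u v \<ge> 0" for u v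
    by simp
  have "?i b d < 1"
    using abd(3) i0[of a b] i0[of a d] by linarith
  then have "?d b d \<noteq> 1"
    by auto
  then have 2: "?d b d \<ge> 2"
    using abd(4) by linarith
  have 3: "?d a b \<ge> 3"
  proof (rule ccontr)
    assume "\<not> ?thesis"
    then have "?i a b \<ge> 1 / real 2" "?i b d \<ge> 1 / real 2"
      by (intro recip_le; use abd(5) 2 in linarith)+
    then show False
      using abd(3) i0[of a d] by simp
  qed
  have 4: "?d a d \<ge> 4"
  proof (rule ccontr)
    assume "\<not> ?thesis"
    then have "?i a b \<ge> 1 / real 3" "?i b d \<ge> 1 / real 3" "?i a d \<ge> 1 / real 3"
      by (intro recip_le; use abd(4-6) 2 in linarith)+
    then show False
      using abd(3) by simp
  qed
  show thesis
    using that[of a b d] abd 2 3 4 by blast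
qed

text \<open>Serve the pairs in the order of their codegree bounds 2, 3, 4: the new vertex must avoid
  1, 2, 3 vertices respectively, namely the third vertex of the triple and the earlier
  choices.\<close>

lemma spokes_bound:
  assumes L: "r_graph 3 V L" and free: "\<And>ws. \<not> realises spokes ws L"
  shows "3 * card L \<le> 3 * card (shadow 3 L)"
proof (rule ccontr)
  assume "\<not> ?thesis"
  then obtain a b d where abd: "{a, b, d} \<in> L" "distinct [a, b, d]" "card (nbr L {b, d}) \<ge> 2"
      "card (nbr L {a, b}) \<ge> 3" "card (nbr L {a, d}) \<ge> 4"
    using light_triple[OF L] by (metis linorder_not_less)
  obtain x where x: "x \<in> nbr L {b, d}" "x \<notin> set [a]"
    using obtain_new[of "[a]" "nbr L {b, d}"] abd by auto
  obtain y where y: "y \<in> nbr L {a, b}" "y \<notin> set [d, x]"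
    using obtain_new[of "[d, x]" "nbr L {a, b}"] abd by auto
  obtain z where z: "z \<in> nbr L {a, d}" "z \<notin> set [b, x, y]"
    using obtain_new[of "[b, x, y]" "nbr L {a, d}"] abd by auto
  have "realises spokes [a, b, d, x, z, y] L"
    using abd x y z by (auto simp: realises_patterns nbr_def insert_commute)
  then show False
    using free by blast
qed

section \<open>Minimal counterexamples and the paths with four edges\<close>

lemma realises_subset: "realises P ws L \<Longrightarrow> L \<subseteq> L' \<Longrightarrow> realises P ws L'"
  by (auto simp: realises_def)

text \<open>The data of \<open>shadow_bound_deletion\<close> without the bound for the remaining
  graph, which induction supplies; \<open>A \<noteq> {}\<close> makes the graph shrink.\<close>

definition reducible :: "nat \<Rightarrow> nat \<Rightarrow> 'a set set \<Rightarrow> bool" where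
  "reducible k m L \<longleftrightarrow> (\<exists>A K. A \<noteq> {} \<and> A \<subseteq> L \<and> K \<subseteq> shadow k L \<and>
     (\<forall>S\<in>K. \<forall>e\<in>L. S \<subseteq> e \<longrightarrow> e \<in> A) \<and> k * card A \<le> m * card K)"

lemma reducibleI:
  assumes "A \<noteq> {}" "A \<subseteq> L" "K \<subseteq> shadow k L"
    and "\<And>S e. e \<in> L \<Longrightarrow> S \<in> K \<Longrightarrow> S \<subseteq> e \<Longrightarrow> e \<in> A"
    and "k * card A \<le> m * card K"
  shows "reducible k m L"
  unfolding reducible_def
  by (intro exI[of _ A] exI[of _ K] conjI ballI impI) (fact assms | rule assms(4); assumption)+

text \<open>A shadow element of degree one may be deleted together with its edge when \<open>k \<le> m\<close>;
  so a minimal counterexample has minimum codegree at least two.\<close>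

lemma pattern_bound_induct:
  assumes L: "r_graph k V L" and free: "\<And>ws. \<not> realises P ws L"
    and k: "1 \<le> k" "k \<le> m"
    and step: "\<And>L. r_graph k V L \<Longrightarrow> (\<And>ws. \<not> realises P ws L) \<Longrightarrow>
      (\<And>S v. v \<in> nbr L S \<Longrightarrow> \<exists>w\<in>nbr L S. w \<noteq> v) \<Longrightarrow> m * card (shadow k L) < k * card L \<Longrightarrow>
      reducible k m L"
  shows "k * card L \<le> m * card (shadow k L)"
  using L free
proof (induction "card L" arbitrary: L rule: less_induct)
  case less
  note L = less.prems(1)
  show ?case
  proof (rule ccontr)
    assume dense: "\<not> ?thesis"
    have "reducible k m L"
    proof (cases "\<exists>S v. v \<in> nbr L S \<and> (\<forall>w\<in>nbr L S. w = v)")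
      case True
      then obtain S v where S: "nbr L S = {v}"
        by auto
      then have v: "v \<notin> S" "insert v S \<in> L"
        by (auto simp: nbr_def)
      then have "finite S" "card S = k - 1"
        using r_graphD(4,5)[OF L v(2)] by auto
      then have shadow: "S \<in> shadow k L"
        using v by (auto simp: shadow_def)
      have "e = insert v S" if e: "e \<in> L" "S \<subseteq> e" for e
      proof -
        have "card (e - S) = 1"
          using r_graphD(4,5)[OF L e(1)] \<open>card S = k - 1\<close> \<open>finite S\<close> e k
          by (simp add: card_Diff_subset)
        then obtain w where w: "e - S = {w}"
          by (auto simp: card_1_singleton_iff)
        then have "insert w S = e" "w \<notin> S"
          using e by auto
        then have "w \<in> nbr L S"
          using e by (simp add: nbr_def)
        then show ?thesis
          using S \<open>insert w S = e\<close> by simp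
      qed
      then show ?thesis
        using v shadow k by (intro reducibleI[of "{insert v S}" L "{S}"]) auto
    next
      case False
      then show ?thesis
        using L less.prems(2) dense by (intro step) (auto simp: not_le)
    qed
    then obtain A K where AK: "A \<noteq> {}" "A \<subseteq> L" "K \<subseteq> shadow k L"
        "\<forall>S\<in>K. \<forall>e\<in>L. S \<subseteq> e \<longrightarrow> e \<in> A" "k * card A \<le> m * card K"
      unfolding reducible_def by (elim exE conjE)
    have "L - A \<subset> L"
      using AK(1,2) by blast
    then have "card (L - A) < card L"
      by (rule psubset_card_mono[OF r_graphD(2)[OF L]])
    moreover have "\<not> realises P ws (L - A)" for ws
      using less.prems(2) realises_subset by blast
    ultimately have "k * card (L - A) \<le> m * card (shadow k (L - A))"
      using less.hyps r_graph_subset[OF L] by blast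
    then show False
      using shadow_bound_deletion[OF L AK(2,3) _ AK(5)] AK(4) dense by blast
  qed
qed

text \<open>The greedy path is blocked only by a triangle \<open>a\<close>, \<open>b\<close>,
  \<open>x\<close> in which \<open>b\<close> and \<open>x\<close> have no further neighbours, and
  such a triangle is deletable.\<close>

lemma path4_bound:
  assumes "r_graph 2 V L" "\<And>ws. \<not> realises path4 ws L"
  shows "2 * card L \<le> 3 * card (shadow 2 L)"
proof (rule pattern_bound_induct[OF assms])
  fix L :: "'a set set"
  assume L: "r_graph 2 V L" and free: "\<And>ws. \<not> realises path4 ws L"
    and deg: "\<And>S v. v \<in> nbr L S \<Longrightarrow> \<exists>w\<in>nbr L S. w \<noteq> v"
    and dense: "3 * card (shadow 2 L) < 2 * card L"
  obtain a b where ab: "{a, b} \<in> L" "a \<noteq> b" "card (nbr L {a}) > 3" "card (nbr L {b}) \<ge> 2"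
    using light_pair[OF L, of 3] dense by auto
  obtain x where x: "x \<in> nbr L {b}" "x \<notin> set [a]"
    using obtain_new[of "[a]" "nbr L {b}"] ab by auto
  \<comment> \<open>A further neighbour \<open>w\<close> of \<open>x\<close> would give the path
    \<open>y a b x w\<close>; four neighbours of \<open>a\<close> leave a choice of \<open>y\<close>
    outside \<open>b\<close>, \<open>x\<close>, \<open>w\<close>.\<close>
  have nx: "nbr L {x} \<subseteq> {a, b}"
  proof
    fix w assume w: "w \<in> nbr L {x}"
    obtain y where y: "y \<in> nbr L {a}" "y \<notin> set [b, x, w]"
      using obtain_new[of "[b, x, w]" "nbr L {a}"] ab by auto
    then have "realises path4 [y, a, b, x, w] L" if "w \<notin> {a, b}"
      using ab x y w that by (auto simp: realises_patterns nbr_def insert_commute)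
    then show "w \<in> {a, b}"
      using free by blast
  qed
  have "b \<in> nbr L {x}"
    using x by (auto simp: nbr_def insert_commute)
  then have ax: "{a, x} \<in> L"
    using deg[of b "{x}"] nx by (auto simp: nbr_def)
  \<comment> \<open>The same argument with the triangle traversed the other way, along
    \<open>y a x b w\<close>.\<close>
  have nb: "nbr L {b} \<subseteq> {a, x}"
  proof
    fix w assume w: "w \<in> nbr L {b}"
    obtain y where y: "y \<in> nbr L {a}" "y \<notin> set [b, x, w]"
      using obtain_new[of "[b, x, w]" "nbr L {a}"] ab by auto
    then have "realises path4 [y, a, x, b, w] L" if "w \<notin> {a, x}"
      using ab x y w that ax by (auto simp: realises_patterns nbr_def insert_commute)
    then show "w \<in> {a, x}"
      using free by blast
  qed
  \<comment> \<open>Three edges cost two shadow vertices, and 2 * 3 = 3 * 2. The vertex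
    \<open>a\<close> may have other neighbours and stays out of \<open>?K\<close>.\<close>
  let ?A = "{{a, b}, {b, x}, {a, x}}" and ?K = "{{b}, {x}}"
  have AL: "?A \<subseteq> L"
    using ab x ax by (auto simp: nbr_def insert_commute)
  have kill: "e \<in> ?A" if e: "e \<in> L" and S: "S \<in> ?K" "S \<subseteq> e" for S e
  proof -
    obtain u where "u \<in> S" "S = {u}" "u = b \<or> u = x"
      using S by auto
    moreover obtain p q where "e = {p, q}" "p \<noteq> q"
      using r_graphD(4)[OF L e] by (auto simp: card_2_iff)
    ultimately obtain w where w: "e = {u, w}" "u \<noteq> w"
      using S by auto
    then have "w \<in> nbr L {u}"
      using e by (auto simp: nbr_def insert_commute)
    then show ?thesis
      using nx nb w \<open>u = b \<or> u = x\<close> by (auto simp: insert_commute)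
  qed
  have "?K \<subseteq> shadow 2 L"
    using ab(1) x by (auto simp: shadow_def nbr_def)
  moreover have "card ?K = 2"
    using x by (auto simp: nbr_def)
  moreover have "card ?A \<le> 3"
    by (intro card_insert_le_m1) auto
  ultimately show "reducible 2 3 L"
    using AL kill by (intro reducibleI[of ?A L ?K]) auto
qed auto

text \<open>Around a light triple \<open>a\<close>, \<open>b\<close>, \<open>d\<close> the absence
  of the path forces a tetrahedron with a fourth vertex \<open>x\<close> whose pairs with
  \<open>a\<close>, \<open>b\<close>, \<open>d\<close> lie in no other edges; its faces at
  \<open>x\<close> are deletable.\<close>

lemma tight_path_bound:
  assumes "r_graph 3 V L" "\<And>ws. \<not> realises tight_path ws L"
  shows "3 * card L \<le> 3 * card (shadow 3 L)"
proof (rule pattern_bound_induct[OF assms])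
  fix L :: "'a set set"
  assume L: "r_graph 3 V L" and free: "\<And>ws. \<not> realises tight_path ws L"
    and deg: "\<And>S v. v \<in> nbr L S \<Longrightarrow> \<exists>w\<in>nbr L S. w \<noteq> v"
    and dense: "3 * card (shadow 3 L) < 3 * card L"
  let ?N = "\<lambda>x y. nbr L {x, y}"
  have comm: "?N x y = ?N y x" for x y
    by (simp add: insert_commute)
  have N: "z \<in> ?N x y \<longleftrightarrow> z \<noteq> x \<and> z \<noteq> y \<and> {x, y, z} \<in> L" for x y z
    by (auto simp: nbr_def insert_commute)
  have path: False if "distinct [v0, v1, v2, v3, v4, v5]"
      "v0 \<in> ?N v1 v2" "{v1, v2, v3} \<in> L" "v4 \<in> ?N v2 v3" "v5 \<in> ?N v3 v4" for v0 v1 v2 v3 v4 v5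
    using free[of "[v0, v1, v2, v3, v4, v5]"] that
    by (simp add: realises_patterns N insert_commute)
  \<comment> \<open>Otherwise the path \<open>y p q c x w\<close> exists: the large codegree of \<open>{p, q}\<close> leaves room for \<open>y\<close>.\<close>
  have key: "?N c x = {p, q}" if e: "{p, q, c} \<in> L" "distinct [p, q, c]"
      and x: "x \<in> ?N q c" "x \<noteq> p" and big: "card (?N p q) \<ge> 4" for p q c x
  proof -
    have sub: "?N c x \<subseteq> {p, q}"
    proof
      fix w assume w: "w \<in> ?N c x"
      obtain y where y: "y \<in> ?N p q" "y \<notin> set [c, x, w]"
        using obtain_new[of "[c, x, w]" "?N p q"] big by auto
      show "w \<in> {p, q}"
      proof (rule ccontr)
        assume "w \<notin> {p, q}"
        then show False
          using path[of y p q c x w] e x y w by (auto simp: N)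
      qed
    qed
    have "q \<in> ?N c x"
      using e x by (auto simp: N insert_commute)
    \<comment> \<open>Minimum codegree two gives a second neighbour besides \<open>q\<close>, and
      only \<open>p\<close> is left.\<close>
    moreover have "p \<in> ?N c x"
      using deg[OF \<open>q \<in> ?N c x\<close>] sub by auto
    ultimately show ?thesis
      using sub by auto
  qed
  obtain a b d where abd: "{a, b, d} \<in> L" "distinct [a, b, d]"
      "card (?N a b) \<ge> 3" "card (?N a d) \<ge> 4"
    using light_triple[OF L dense] by metis
  then have neq: "a \<noteq> b" "b \<noteq> a" "a \<noteq> d" "d \<noteq> a" "b \<noteq> d" "d \<noteq> b"
    by auto
  \<comment> \<open>This and the converse \<open>sub2\<close> apply \<open>key\<close> to the large
    pair \<open>{a, d}\<close> in its two orders, with \<open>c = b\<close>.\<close>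
  have sub1: "x \<in> ?N a b" if "x \<in> ?N b d" "x \<noteq> a" for x
  proof -
    have "?N b x = {a, d}"
      using key[of a d b x] that abd(1,3,4) neq by (simp add: comm insert_commute)
    then have "a \<in> ?N b x"
      by simp
    then show ?thesis
      using that abd by (auto simp: N insert_commute)
  qed
  have sub2: "x \<in> ?N b d" if "x \<in> ?N a b" "x \<noteq> d" for x
  proof -
    have "?N b x = {d, a}"
      using key[of d a b x] that abd(1,3,4) neq by (simp add: comm insert_commute)
    then have "d \<in> ?N b x"
      by simp
    then show ?thesis
      using that abd by (auto simp: N insert_commute)
  qed
  have mem: "d \<in> ?N a b" "a \<in> ?N b d" "b \<in> ?N a d"
    using abd by (auto simp: N insert_commute)
  have eq: "?N a b - {d} = ?N b d - {a}"
    using sub1 sub2 abd by (auto simp: N)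
  then have same: "card (?N a b) = card (?N b d)"
    using mem finite_nbr[OF L] by (metis card_Suc_Diff1)
  \<comment> \<open>Otherwise there is a tight path \<open>x b a d y w\<close>. The aim is to carry
    the codegree bound 4 from \<open>{a, d}\<close> over to \<open>{a, b}\<close>.\<close>
  have sub3: "y \<in> ?N a b" if y: "y \<in> ?N a d" "y \<noteq> b" for y
  proof (rule ccontr)
    assume y_ab: "y \<notin> ?N a b"
    have "a \<in> ?N d y"
      using y abd by (auto simp: N insert_commute)
    then obtain w where w: "w \<in> ?N d y" "w \<noteq> a"
      using deg by blast
    have "w \<noteq> b"
      using sub1[of y] y w y_ab abd by (auto simp: N insert_commute)
    \<comment> \<open>Three neighbours suffice: only \<open>d\<close> and \<open>w\<close> must be
      avoided, since \<open>y\<close> is not in \<open>?N a b\<close>.\<close>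
    have "\<exists>x\<in>?N a b. x \<noteq> d \<and> x \<noteq> y \<and> x \<noteq> w"
      using obtain_new[of "[d, w]" "?N a b"] abd(3) y_ab by auto
    then obtain x where x: "x \<in> ?N a b" "x \<noteq> d" "x \<noteq> y" "x \<noteq> w"
      by blast
    show False
      using path[of x b a d y w] x y w \<open>w \<noteq> b\<close> abd by (auto simp: N insert_commute)
  qed
  have "?N a d \<subseteq> insert b (?N a b - {d})"
    using sub3 by (auto simp: N)
  then have "?N a d - {b} \<subseteq> ?N a b - {d}"
    by auto
  then have "card (?N a d - {b}) \<le> card (?N a b - {d})"
    using finite_nbr[OF L] by (intro card_mono) auto
  then have "card (?N a d) \<le> card (?N a b)"
    using mem finite_nbr[OF L]
    by (metis card_Suc_Diff1 Suc_le_mono)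
  then have big: "card (?N a b) \<ge> 4" "card (?N b d) \<ge> 4"
    using abd same by auto
  \<comment> \<open>All three pairs of \<open>{a, b, d}\<close> are now large, so the only edges on \<open>x\<close> with one of
    \<open>a\<close>, \<open>b\<close>, \<open>d\<close> are the three that complete a tetrahedron.\<close>
  obtain x where x: "x \<in> ?N a b" "x \<notin> set [d]"
    using obtain_new[of "[d]" "?N a b"] abd(3) by auto
  then have xn: "x \<noteq> a" "x \<noteq> b" "x \<noteq> d" and xbd: "x \<in> ?N b d"
    using sub2[of x] by (auto simp: N)
  have nb: "?N b x = {a, d}"
    using key[of a d b x] xbd xn abd(1,4) neq by (simp add: comm insert_commute)
  have nd: "?N d x = {a, b}"
    using key[of a b d x] xbd xn abd(1) neq big by simp
  then have "a \<in> ?N d x"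
    by simp
  then have xad: "x \<in> ?N a d"
    using xn by (auto simp: N insert_commute)
  have na: "?N a x = {b, d}"
    using key[of b d a x] xad xn abd(1) neq big by (simp add: comm insert_commute)
  \<comment> \<open>The face \<open>{a, b, d}\<close> is kept, as its pairs may lie in other edges.
    Three edges are paid for by the three pairs at \<open>x\<close>.\<close>
  let ?A = "{{a, b, x}, {a, d, x}, {b, d, x}}" and ?K = "{{a, x}, {b, x}, {d, x}}"
  have AL: "?A \<subseteq> L"
    using x(1) xad xbd by (simp add: N insert_commute)
  have kill: "e \<in> ?A" if e: "e \<in> L" and S: "S \<in> ?K" "S \<subseteq> e" for S e
  proof -
    obtain u where u: "S = {u, x}" "u \<in> {a, b, d}" "u \<noteq> x"
      using S xn by auto
    have "card (e - S) = 1"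
      using r_graphD(4,5)[OF L e] S u by (subst card_Diff_subset) auto
    then obtain w where w: "e - S = {w}"
      by (auto simp: card_1_singleton_iff)
    then have ew: "e = {u, x, w}" "w \<noteq> u" "w \<noteq> x"
      using u S by auto
    then have "w \<in> ?N u x"
      using e by (auto simp: N)
    then show ?thesis
      using u na nb nd ew by (auto simp: insert_commute)
  qed
  have "?K \<subseteq> shadow 3 L"
    using na nb nd by (simp add: shadow_eq_nbr[OF L])
  moreover have "card ?K = 3"
    using xn neq by (simp add: doubleton_eq_iff)
  moreover have "card ?A \<le> 3"
    by (intro card_insert_le_m1) auto
  ultimately show "reducible 3 3 L"
    using AL kill by (intro reducibleI[of ?A L ?K]) auto
qed auto

section \<open>Tight trees with at most four edges\<close>

lemma suspension_star:
  assumes "finite S" "card S + 1 = r" "finite W" "W \<inter> S = {}"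
  shows "suspension r 1 (star (card W)) ((\<lambda>w. insert w S) ` W)"
proof -
  obtain vs where vs: "set vs = W" "distinct vs"
    using finite_distinct_list[OF assms(3)] by blast
  then have len: "length vs = card W"
    using distinct_card by fastforce
  have "(\<lambda>w. insert w S) ` W = (\<lambda>i. insert (vs ! i) S) ` {..<length vs}"
    using vs(1) by (force simp: set_conv_nth)
  then have "(\<lambda>w. insert w S) ` W = (\<lambda>I. S \<union> (!) vs ` I) ` star (card W)"
    by (simp add: star_def image_image len)
  then show ?thesis
    unfolding suspension_def Union_patterns using assms vs len
    by (intro exI[of _ S] exI[of _ vs]) simp
qed

text \<open>Stated with nested \<open>insert\<close>, the form in which the edges of a growing tree
  appear in the case analysis.\<close>

lemma suspension_graphs:
  assumes "finite R" "card R + 2 = r"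
  shows "distinct [v0, v1, v2, v3] \<Longrightarrow> set [v0, v1, v2, v3] \<inter> R = {} \<Longrightarrow>
      suspension r 2 path3 {insert v0 (insert v1 R), insert v1 (insert v2 R), insert v2 (insert v3 R)}"
    and "distinct [v0, v1, v2, v3, v4] \<Longrightarrow> set [v0, v1, v2, v3, v4] \<inter> R = {} \<Longrightarrow>
      suspension r 2 path4 {insert v0 (insert v1 R), insert v1 (insert v2 R),
        insert v2 (insert v3 R), insert v3 (insert v4 R)}"
    and "distinct [v0, v1, v2, v3, v4] \<Longrightarrow> set [v0, v1, v2, v3, v4] \<inter> R = {} \<Longrightarrow>
      suspension r 2 broom {insert v0 (insert v2 R), insert v1 (insert v2 R),
        insert v2 (insert v3 R), insert v3 (insert v4 R)}"
  subgoal
    unfolding suspension_def Union_patterns using assms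
    by (intro exI[of _ R] exI[of _ "[v0, v1, v2, v3]"]) (simp add: path3_def)
  subgoal
    unfolding suspension_def Union_patterns using assms
    by (intro exI[of _ R] exI[of _ "[v0, v1, v2, v3, v4]"]) (simp add: path4_def)
  subgoal
    unfolding suspension_def Union_patterns using assms
    by (intro exI[of _ R] exI[of _ "[v0, v1, v2, v3, v4]"]) (simp add: broom_def)
  done

lemma suspension_triples:
  assumes "finite R" "card R + 3 = r"
    and "distinct [v0, v1, v2, v3, v4, v5]" "set [v0, v1, v2, v3, v4, v5] \<inter> R = {}"
  shows "suspension r 3 spokes {insert v0 (insert v1 (insert v2 R)), insert v1 (insert v2 (insert v3 R)),
      insert v0 (insert v2 (insert v4 R)), insert v0 (insert v1 (insert v5 R))}"
    and "suspension r 3 tight_path {insert v0 (insert v1 (insert v2 R)), insert v1 (insert v2 (insert v3 R)),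
      insert v2 (insert v3 (insert v4 R)), insert v3 (insert v4 (insert v5 R))}"
  subgoal
    unfolding suspension_def Union_patterns using assms
    by (intro exI[of _ R] exI[of _ "[v0, v1, v2, v3, v4, v5]"]) (simp add: spokes_def)
  subgoal
    unfolding suspension_def Union_patterns using assms
    by (intro exI[of _ R] exI[of _ "[v0, v1, v2, v3, v4, v5]"]) (simp add: tight_path_def)
  done

section \<open>Adding one edge to a tight tree\<close>

definition grows :: "'a set set \<Rightarrow> 'a set \<Rightarrow> bool" where
  "grows T e \<longleftrightarrow> (\<exists>s\<in>T. \<exists>u\<in>s. \<exists>v. v \<notin> \<Union>T \<and> e = insert v (s - {u}))"

text \<open>The new edge without \<open>v\<close> has \<open>r - 1\<close> vertices, all in an older
  edge \<open>es ! s\<close>, so exactly one vertex \<open>u\<close> of that edge is exchanged for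
  \<open>v\<close>. This removes indices from the later case analysis.\<close>

lemma tight_tree_grows:
  assumes T: "tight_tree r T" and r: "r \<ge> 1"
  obtains es where "distinct es" "set es = T" "es \<noteq> []"
    "\<And>i. 1 \<le> i \<Longrightarrow> i < length es \<Longrightarrow> grows (set (take i es)) (es ! i)"
proof -
  have G: "r_graph r (\<Union>T) T"
    using T by (simp add: tight_tree_def)
  obtain es where es: "distinct es" "set es = T" "es \<noteq> []"
      "\<And>i. 1 \<le> i \<Longrightarrow> i < length es \<Longrightarrow>
        \<exists>v\<in>es ! i. \<exists>s<i. v \<notin> (\<Union>j<i. es ! j) \<and> es ! i - {v} \<subseteq> es ! s"
    using T unfolding tight_tree_def by blast
  have "grows (set (take i es)) (es ! i)" if i: "1 \<le> i" "i < length es" for i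
  proof -
    obtain v s where v: "v \<in> es ! i" "s < i" "v \<notin> (\<Union>j<i. es ! j)" "es ! i - {v} \<subseteq> es ! s"
      using es(4)[OF i] by blast
    have "es ! i \<in> T" "es ! s \<in> T"
      using es(2) i v(2) by auto
    then have fin: "finite (es ! i)" "finite (es ! s)" "card (es ! i) = r" "card (es ! s) = r"
      using r_graphD(4,5)[OF G] by auto
    then have "card (es ! s - (es ! i - {v})) = 1"
      using v r by (simp add: card_Diff_subset)
    then obtain u where u: "es ! s - (es ! i - {v}) = {u}"
      by (auto simp: card_1_singleton_iff)
    have take: "set (take i es) = (!) es ` {..<i}"
      using i by (auto simp: nth_image[symmetric] atLeast0LessThan)
    have "es ! i = insert v (es ! s - {u})" "u \<in> es ! s"
      using u v by auto
    then show ?thesis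
      unfolding grows_def take using v(2,3) by blast
  qed
  then show thesis
    using that es(1-3) by blast
qed

lemma grows_singleton:
  assumes "grows {e0} e1"
  obtains S u v where "e0 = insert u S" "e1 = insert v S" "u \<noteq> v" "u \<notin> S" "v \<notin> S"
proof -
  obtain u v where "u \<in> e0" "v \<notin> e0" "e1 = insert v (e0 - {u})"
    using assms by (auto simp: grows_def)
  then show thesis
    using that[of u "e0 - {u}" v] by auto
qed

text \<open>If the exchanged vertex is the private one, the star gains an edge. If it is a vertex
  \<open>u\<close> of the core, then over the remaining core \<open>R\<close> the star is a graph
  star with centre \<open>u\<close>, and the new edge hangs on its leaf \<open>w\<close>.\<close>

lemma grows_star:
  assumes T: "grows T e" "T = (\<lambda>w. insert w S) ` W" and W: "W \<inter> S = {}"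
  obtains (star) v where "v \<notin> S" "v \<notin> W" "e = insert v S"
    | (branch) R w u v where "w \<in> W" "S = insert u R" "u \<notin> R" "v \<notin> S" "v \<notin> W"
        "e = insert v (insert w R)"
proof -
  obtain w u v where w: "w \<in> W" "u \<in> insert w S" "v \<notin> \<Union>T" "e = insert v (insert w S - {u})"
    using T by (auto simp: grows_def)
  have v: "v \<notin> S" "v \<notin> W"
    using w(1,3) T(2) by auto
  show thesis
  proof (cases "u = w")
    case True
    then have "e = insert v S"
      using w W by auto
    then show thesis
      using star v by blast
  next
    case False
    then have "u \<in> S" "e = insert v (insert w (S - {u}))"
      using w by auto
    then show thesis
      using branch[of w u "S - {u}" v] w(1) v by (auto simp: insert_absorb)
  qed
qed

text \<open>An end edge that drops its end vertex gives the broom, its inner vertex the longer path,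
  a core vertex the tight path. The middle edge gives the broom, or the spokes when it drops a core
  vertex.\<close>

lemma grows_path3:
  assumes T: "grows {insert a (insert b R), insert b (insert c R), insert c (insert d R)} e" (is "grows ?T e")
    and R: "finite R" "card R + 2 = r"
    and dist: "distinct [a, b, c, d]" "set [a, b, c, d] \<inter> R = {}"
  shows "suspension r 2 path4 (insert e ?T) \<or> suspension r 2 broom (insert e ?T) \<or>
    suspension r 3 spokes (insert e ?T) \<or> suspension r 3 tight_path (insert e ?T)"
proof -
  obtain s u v where s: "s \<in> ?T" "u \<in> s" "v \<notin> \<Union>?T" "e = insert v (s - {u})"
    using T unfolding grows_def by blast
  have v: "v \<notin> {a, b, c, d}" "v \<notin> R"
    using s(3) by auto
  have dist': "distinct [d, c, b, a]"
    using dist(1) by auto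
  have R_minus: "finite (R - {u})" "card (R - {u}) + 3 = r" "R = insert u (R - {u})" if "u \<in> R"
    using that R card_Suc_Diff1[of R u] by (auto simp: insert_absorb)
  \<comment> \<open>Stated for renamed vertices so that the last edge follows by reading the path
    backwards.\<close>
  have end_edge: ?thesis
    if T: "?T = {insert a' (insert b' R), insert b' (insert c' R), insert c' (insert d' R)}"
      and dist: "distinct [a', b', c', d']" "set [a', b', c', d'] \<inter> R = {}" "v \<notin> {a', b', c', d'}"
      and s: "s = insert a' (insert b' R)" for a' b' c' d'
  proof -
    consider "u = a'" | "u = b'" | "u \<in> R"
      using \<open>u \<in> s\<close> s by auto
    then show ?thesis
    proof cases
      case 1
      then have "e = insert v (insert b' R)"
        using \<open>e = _\<close> s dist by auto
      then show ?thesis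
        using suspension_graphs(3)[OF R, of v a' b' c' d'] dist v(2) unfolding T by simp
    next
      case 2
      then have "e = insert v (insert a' R)"
        using \<open>e = _\<close> s dist by auto
      then show ?thesis
        using suspension_graphs(2)[OF R, of v a' b' c' d'] dist v(2) unfolding T by simp
    next
      case 3
      \<comment> \<open>Over \<open>Q\<close> the old edges are \<open>a' b' u\<close>,
        \<open>b' u c'\<close>, \<open>u c' d'\<close>; the new edge \<open>v a' b'\<close> precedes
        them in a tight path.\<close>
      define Q where "Q = R - {u}"
      have Q: "finite Q" "card Q + 3 = r" "R = insert u Q" "u \<notin> Q"
        using R_minus[OF 3] by (auto simp: Q_def)
      then have "e = insert v (insert a' (insert b' Q))"
        using \<open>e = _\<close> s dist by auto
      moreover have "a' \<noteq> u" "b' \<noteq> u" "c' \<noteq> u" "d' \<noteq> u"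
        using dist Q(3) by auto
      ultimately show ?thesis
        using suspension_triples(2)[OF Q(1,2), of v a' b' u c' d'] dist v(2) Q(3,4)
        unfolding T by (simp add: insert_commute)
    qed
  qed
  consider "s = insert a (insert b R)" | "s = insert b (insert c R)" | "s = insert c (insert d R)"
    using s(1) by auto
  then show ?thesis
  proof cases
    case 1
    show ?thesis
      by (rule end_edge[OF refl dist v(1) 1])
  next
    case 3
    show ?thesis
      by (rule end_edge[of d c b a]) (use dist v 3 in \<open>auto simp: insert_commute\<close>)
  next
    case 2
    consider "u = b" | "u = c" | "u \<in> R"
      using s(2) 2 by auto
    then show ?thesis
    proof cases
      case 1
      then have "e = insert v (insert c R)"
        using s(4) 2 dist by auto
      then show ?thesis
        using suspension_graphs(3)[OF R, of v d c b a] dist dist' v by (simp add: insert_commute)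
    next
      case 2
      then have "e = insert v (insert b R)"
        using s(4) \<open>s = _\<close> dist by auto
      then show ?thesis
        using suspension_graphs(3)[OF R, of v a b c d] dist v by (simp add: insert_commute)
    next
      case 3
      define Q where "Q = R - {u}"
      have Q: "finite Q" "card Q + 3 = r" "R = insert u Q" "u \<notin> Q"
        using R_minus[OF 3] by (auto simp: Q_def)
      then have "e = insert v (insert b (insert c Q))"
        using s(4) 2 dist by auto
      \<comment> \<open>The centre of the spokes is \<open>{b, u, c}\<close>: \<open>d\<close>
        completes \<open>{u, c}\<close>, \<open>v\<close> completes \<open>{b, c}\<close> and
        \<open>a\<close> completes \<open>{b, u}\<close>.\<close>
      moreover have "distinct [b, u, c, d, v, a]" "set [b, u, c, d, v, a] \<inter> Q = {}"
        using dist v Q(3,4) by auto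
      ultimately show ?thesis
        using suspension_triples(1)[OF Q(1,2), of b u c d v a] Q(3)
        by (simp add: insert_commute)
    qed
  qed
qed

text \<open>One or two edges always form a star. A third edge extends the star or creates
  \<open>path3\<close>; a fourth edge extends the star, turns it into a broom, or falls under
  \<open>grows_path3\<close>.\<close>

lemma small_tight_tree_cases:
  assumes T: "tight_tree r T" and r: "r \<ge> 1" and t: "card T \<le> 4"
  shows "card T \<ge> 1 \<and> (suspension r 1 (star (card T)) T \<or>
    card T = 3 \<and> suspension r 2 path3 T \<or>
    card T = 4 \<and> (suspension r 2 path4 T \<or> suspension r 2 broom T \<or>
      suspension r 3 spokes T \<or> suspension r 3 tight_path T))"
proof -
  obtain es where es: "distinct es" "set es = T" "es \<noteq> []"
      "\<And>i. 1 \<le> i \<Longrightarrow> i < length es \<Longrightarrow> grows (set (take i es)) (es ! i)"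
    using tight_tree_grows[OF T r] by blast
  have G: "r_graph r (\<Union>T) T"
    using T by (simp add: tight_tree_def)
  have len: "length es = card T"
    using es distinct_card by fastforce
  obtain e0 es1 where es1: "es = e0 # es1"
    using es(3) by (cases es) auto
  have e0: "finite e0" "card e0 = r"
    using r_graphD(4,5)[OF G] es es1 by auto
  show ?thesis
  proof (cases es1)
    case Nil
    obtain u where u: "u \<in> e0"
      using e0 r by fastforce
    have "suspension r 1 (star (card {u})) ((\<lambda>w. insert w (e0 - {u})) ` {u})"
      using u e0 r by (intro suspension_star) auto
    then show ?thesis
      using es es1 Nil u len by (simp add: insert_absorb)
  next
    case (Cons e1 es2)
    have "grows {e0} e1"
      using es(4)[of 1] es1 Cons by simp
    then obtain S u v where S: "e0 = insert u S" "e1 = insert v S" "u \<noteq> v" "u \<notin> S" "v \<notin> S"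
      by (rule grows_singleton)
    have cS: "finite S" "card S + 1 = r"
      using e0 S by auto
    show ?thesis
    proof (cases es2)
      case Nil
      then show ?thesis
        using suspension_star[of S r "{u, v}"] cS S es es1 Cons len by auto
    next
      case (Cons e2 es3)
      note es2 = \<open>es1 = _\<close> Cons
      have g2: "grows {e0, e1} e2"
        using es(4)[of 2] es1 es2 by (simp add: numeral_2_eq_2)
      have T2: "{e0, e1} = (\<lambda>w. insert w S) ` {u, v}" "{u, v} \<inter> S = {}"
        using S by auto
      consider (star) w where "w \<notin> S" "w \<notin> {u, v}" "e2 = insert w S"
        | (branch) R y q w where "y \<in> {u, v}" "S = insert q R" "q \<notin> R" "w \<notin> S" "w \<notin> {u, v}"
            "e2 = insert w (insert y R)"
        by (rule grows_star[OF g2 T2])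
      then show ?thesis
      proof cases
        case star
        have T3: "{e0, e1, e2} = (\<lambda>w. insert w S) ` {u, v, w}"
          using S star by auto
        show ?thesis
        proof (cases es3)
          case Nil
          then show ?thesis
            using suspension_star[of S r "{u, v, w}"] cS S star T3 es es1 es2 len by auto
        next
          case (Cons e3 es4)
          then have "es4 = []"
            using t es1 es2 unfolding len[symmetric] by simp
          then have T4: "T = {e0, e1, e2, e3}" "card T = 4"
            using es(2) es1 es2 Cons len by auto
          have g3: "grows {e0, e1, e2} e3"
            using es(4)[of 3] es1 es2 Cons by (simp add: numeral_3_eq_3)
          have disj: "{u, v, w} \<inter> S = {}"
            using S star by auto
          consider (star4) x where "x \<notin> S" "x \<notin> {u, v, w}" "e3 = insert x S"
            | (broom) R y q x where "y \<in> {u, v, w}" "S = insert q R" "q \<notin> R" "x \<notin> S"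
                "x \<notin> {u, v, w}" "e3 = insert x (insert y R)"
            by (rule grows_star[OF g3 T3 disj])
          then show ?thesis
          proof cases
            case 3: star4
            have "T = (\<lambda>w. insert w S) ` {u, v, w, x}"
              using T4 S star 3 by auto
            moreover have "card {u, v, w, x} = 4"
              using S star 3 by auto
            ultimately show ?thesis
              using suspension_star[of S r "{u, v, w, x}"] cS S star 3 T4(2) by auto
          next
            case 4: broom
            have R: "finite R" "card R + 2 = r"
              using cS 4 by auto
            \<comment> \<open>Here \<open>q\<close> is the centre of the broom, \<open>y\<close> the
              leaf that carries the new edge to \<open>x\<close>, and \<open>p1\<close>,
              \<open>p2\<close> are the other two leaves.\<close>
            have sus: "suspension r 2 broom T"
              if p: "{p1, p2, y} = {u, v, w}" "distinct [p1, p2, y]" for p1 p2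
            proof -
              have "T = insert e3 ((\<lambda>w. insert w S) ` {p1, p2, y})"
                unfolding p(1) T3[symmetric] T4(1) by auto
              moreover have "{p1, p2, y, x} \<inter> S = {}" "x \<notin> {p1, p2, y}"
                using disj 4 unfolding p(1)[symmetric] by auto
              moreover from this have "distinct [p1, p2, q, y, x]" "set [p1, p2, q, y, x] \<inter> R = {}"
                using p(2) 4 by auto
              ultimately show ?thesis
                using suspension_graphs(3)[OF R, of p1 p2 q y x] 4
                by (simp add: insert_commute)
            qed
            have "w \<noteq> u" "w \<noteq> v"
              using star(2) by auto
            then have "suspension r 2 broom T"
              using \<open>y \<in> {u, v, w}\<close> sus[of u v] sus[of u w] sus[of v w] S(3) by auto
            then show ?thesis
              using T4(2) by simp
          qed
        qed
      next
        case branch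
        \<comment> \<open>With \<open>z\<close> the other one of \<open>u\<close> and
          \<open>v\<close>, the three edges form the path \<open>w y q z\<close> over
          \<open>R\<close>.\<close>
        obtain z where z: "{y, z} = {u, v}" "y \<noteq> z"
          using branch S by auto
        have R: "finite R" "card R + 2 = r"
          using cS branch by auto
        have "insert e2 {e0, e1} = insert e2 ((\<lambda>w. insert w S) ` {y, z})"
          unfolding z(1) T2(1) ..
        then have T3: "{e0, e1, e2} = {insert w (insert y R), insert y (insert q R), insert q (insert z R)}"
          using branch(2,6) by (simp add: insert_commute)
        have "{y, z} \<inter> S = {}" "w \<notin> {y, z}"
          unfolding z(1) using T2(2) branch(5) by auto
        then have dist: "distinct [w, y, q, z]" "set [w, y, q, z] \<inter> R = {}"
          using z(2) branch(2-4) by auto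
        show ?thesis
        proof (cases es3)
          case Nil
          then have "T = {e0, e1, e2}" "card T = 3"
            using es(2) es1 es2 len by auto
          then show ?thesis
            using suspension_graphs(1)[OF R dist] T3 by simp
        next
          case (Cons e3 es4)
          then have "es4 = []"
            using t es1 es2 unfolding len[symmetric] by simp
          then have T4: "T = insert e3 {e0, e1, e2}" "card T = 4"
            using es(2) es1 es2 Cons len by auto
          have "grows {e0, e1, e2} e3"
            using es(4)[of 3] es1 es2 Cons by (simp add: numeral_3_eq_3)
          then show ?thesis
            using grows_path3[OF _ R dist, of e3] T4 unfolding T3 by simp
        qed
      qed
    qed
  qed
qed

theorem theorem1:
  fixes r :: nat and T :: "'b set set" and V :: "'a set" and E :: "'a set set"
  assumes "r \<ge> 2"
    and "tight_tree r T"
    and "card T \<le> 4"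
    and "r_graph r V E"
    and "\<not> contains_copy V E T"
  shows "real (card E) \<le> (real (card T) - 1) / real r * real (card (shadow r E))"
proof -
  have cases: "card T \<ge> 1" "suspension r 1 (star (card T)) T \<or>
      card T = 3 \<and> suspension r 2 path3 T \<or>
      card T = 4 \<and> (suspension r 2 path4 T \<or> suspension r 2 broom T \<or>
        suspension r 3 spokes T \<or> suspension r 3 tight_path T)"
    using small_tight_tree_cases[of r T] assms(1-3) by auto
  note bound = suspension_bound[OF assms(4) _ _ assms(5)]
  \<comment> \<open>In each case the pattern bound has the factor \<open>card T - 1\<close> on the
    shadow side.\<close>
  have "r * card E \<le> (card T - 1) * card (shadow r E)"
    using cases(2)
  proof (elim disjE conjE)
    assume "suspension r 1 (star (card T)) T"
    then show ?thesis
      by (rule bound[OF order_refl]) (rule star_bound)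
  next
    assume "card T = 3" "suspension r 2 path3 T"
    then show ?thesis
      using bound[of 2 path3 2] path3_bound by auto
  next
    assume "card T = 4" "suspension r 2 path4 T"
    then show ?thesis
      using bound[of 2 path4 3] path4_bound by auto
  next
    assume "card T = 4" "suspension r 2 broom T"
    then show ?thesis
      using bound[of 2 broom 3] broom_bound by auto
  next
    assume "card T = 4" "suspension r 3 spokes T"
    then show ?thesis
      using bound[of 3 spokes 3] spokes_bound by auto
  next
    assume "card T = 4" "suspension r 3 tight_path T"
    then show ?thesis
      using bound[of 3 tight_path 3] tight_path_bound by auto
  qed
  then have "real (r * card E) \<le> real ((card T - 1) * card (shadow r E))"
    by (simp only: of_nat_le_iff)
  \<comment> \<open>Since \<open>card T \<ge> 1\<close>, the truncated difference agrees with the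
    real one.\<close>
  then have "real r * real (card E) \<le> (real (card T) - 1) * real (card (shadow r E))"
    using cases(1) by (simp add: of_nat_diff)
  then show ?thesis
    using assms(1) by (simp add: field_simps)
qed

end
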